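(* No sphere in $\mathbb{R}^3$ admits an isothermal parametrization with harmonic metric coefficient. That is, if $S\subset\mathbb{R}^3$ is a round sphere of radius $r>0$ and $U\subseteq\mathbb{R}^2$ is a nonempty open connected set with coordinates $(u,v)$, then there is no smooth immersion $i:U\to\mathbb{R}^3$ with $i(U)\subseteq S$ whose first fundamental form has coefficients $g_{ij}(u,v)=E(u,v)\,\delta_{ij}$ with $E:U\to\mathbb{R}$ strictly positive and harmonic.
   Context: For a smooth immersion $i:U\to\mathbb{R}^3$ with coordinates $(x_1,x_2)=(u,v)$ on $U$, the first fundamental form has coefficients $g_{ij}=\langle \partial_{x_i} i,\partial_{x_j} i\rangle$. $\delta_{ij}$ is the Kronecker delta. A function $E$ on $U$ is harmonic if $\partial_u^2E+\partial_v^2E=0$ on $U$. *)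

theory Defs
  imports "HOL-Analysis.Analysis"
begin

definition partial_deriv ::
    "'n::finite \<Rightarrow> (real^'n \<Rightarrow> 'b::real_normed_vector) \<Rightarrow> real^'n \<Rightarrow> 'b" where
  "partial_deriv j f x = vector_derivative (\<lambda>t. f (x + t *\<^sub>R axis j 1)) (at 0)"

text \<open>Intended for open sets \<open>S\<close> only: the derivatives at points of \<open>S\<close> are
  two-sided, so for open \<open>S\<close> they depend only on the values of \<open>f\<close> on \<open>S\<close>.
  Differentiability is the total (Frechet) one.\<close>

primrec C_k_on ::
    "nat \<Rightarrow> (real^'n::finite \<Rightarrow> 'b::real_normed_vector) \<Rightarrow> (real^'n) set \<Rightarrow> bool" where
  "C_k_on 0 f S \<longleftrightarrow> continuous_on S f"
| "C_k_on (Suc k) f S \<longleftrightarrow>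
     (\<forall>x\<in>S. f differentiable (at x)) \<and> (\<forall>j. C_k_on k (partial_deriv j f) S)"

definition smooth_on ::
    "(real^'n::finite \<Rightarrow> 'b::real_normed_vector) \<Rightarrow> (real^'n) set \<Rightarrow> bool" where
  "smooth_on f S \<longleftrightarrow> (\<forall>k. C_k_on k f S)"

definition smooth_immersion_on ::
    "(real^'n::finite \<Rightarrow> real^'m::finite) \<Rightarrow> (real^'n) set \<Rightarrow> bool" where
  "smooth_immersion_on f S \<longleftrightarrow>
     smooth_on f S \<and> (\<forall>x\<in>S. inj (frechet_derivative f (at x)))"

definition first_fundamental_form ::
    "(real^2 \<Rightarrow> real^3) \<Rightarrow> 2 \<Rightarrow> 2 \<Rightarrow> real^2 \<Rightarrow> real" where
  "first_fundamental_form f i j x = partial_deriv i f x \<bullet> partial_deriv j f x"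

text \<open>The \<open>C\<^sup>2\<close> requirement makes the second partial derivatives meaningful, since
  \<^const>\<open>vector_derivative\<close> has an unspecified value where no derivative exists.
  It holds automatically for a coefficient of the first fundamental form of a smooth map.\<close>

definition harmonic_on :: "(real^2 \<Rightarrow> real) \<Rightarrow> (real^2) set \<Rightarrow> bool" where
  "harmonic_on f S \<longleftrightarrow> C_k_on 2 f S \<and>
     (\<forall>x\<in>S. partial_deriv 1 (partial_deriv 1 f) x + partial_deriv 2 (partial_deriv 2 f) x = 0)"

definition kronecker_delta :: "'n \<Rightarrow> 'n \<Rightarrow> real" where
  "kronecker_delta i j = (if i = j then 1 else 0)"

end

theory Submission
  imports Defs
begin

text \<open>
  An isothermal parametrization \<open>f\<close> of a sphere of radius \<open>r\<close> satisfies Gauss's equation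
  \<open>E \<Delta>E = |\<nabla>E|\<^sup>2 - 2 E\<^sup>3 / r\<^sup>2\<close>, which says that the metric \<open>E (du\<^sup>2 + dv\<^sup>2)\<close> has curvature
  \<open>1 / r\<^sup>2\<close> (\<open>gauss_equation_conformal_sphere\<close>). If \<open>E\<close> is harmonic, this becomes
  \<open>|\<nabla>E|\<^sup>2 = k E\<^sup>3\<close> with \<open>k = 2 / r\<^sup>2 > 0\<close>, and no positive harmonic function satisfies such an
  equation (\<open>no_positive_harmonic_gradient_cubic\<close>). The complex-analytic reason is that
  \<open>h = E\<^sub>u - i E\<^sub>v\<close> is holomorphic with \<open>|h|\<^sup>2 = k E\<^sup>3\<close>; since \<open>h\<close> has no zeros, \<open>ln |h|\<close>, and hence
  \<open>ln E\<close>, would be harmonic, but \<open>\<Delta> (ln E) = - |\<nabla>E|\<^sup>2 / E\<^sup>2 < 0\<close>.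

  Both halves depend on exchanging partial derivatives. This is proved under the hypotheses of
  Young's theorem (differentiable first derivatives, no continuity of the second ones), and that
  form matters: with it, \<open>E\<close> of class \<open>C\<^sup>2\<close> suffices for the second half, because the equations
  express the second derivatives of \<open>E\<close> through its first ones, and so make them differentiable.
\<close>

section \<open>Symmetry of second derivatives\<close>

text \<open>
  The second difference is the increment over \<open>[0, h]\<close> of
  \<open>s \<mapsto> g (a + s v + h w) - g (a + s v)\<close>. The mean value theorem in \<open>s\<close> turns it into \<open>h\<close> times a
  difference of two values of \<open>G _ v\<close>, whose linear approximation at the single point \<open>a\<close>
  gives \<open>h P w\<close> up to \<open>o(h)\<close>.
\<close>

lemma second_difference_estimate:
  fixes g :: "'a::real_normed_vector \<Rightarrow> real"
  assumes "open S" "a \<in> S"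
    and G: "\<And>x. x \<in> S \<Longrightarrow> (g has_derivative G x) (at x)"
    and P: "((\<lambda>x. G x v) has_derivative P) (at a)" and "e > 0"
  shows "\<exists>d>0. \<forall>h. 0 < h \<and> h < d \<longrightarrow>
    \<bar>g (a + h *\<^sub>R v + h *\<^sub>R w) - g (a + h *\<^sub>R v) - g (a + h *\<^sub>R w) + g a - h\<^sup>2 * P w\<bar> \<le> e * h\<^sup>2"
proof -
  define C where "C = norm v + norm w + 1"
  have C: "C > 0" unfolding C_def by (simp add: add_nonneg_pos)
  define e' where "e' = e / (2 * C)"
  have e': "e' > 0" using C \<open>e > 0\<close> by (simp add: e'_def)
  obtain d0 where d0: "d0 > 0" "ball a d0 \<subseteq> S"
    using assms(1,2) open_contains_ball by blast
  obtain d1 where d1: "d1 > 0"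
    "\<And>y. norm (y - a) < d1 \<Longrightarrow> norm (G y v - G a v - P (y - a)) \<le> e' * norm (y - a)"
    using P e' unfolding has_derivative_at_alt by blast
  have linP: "linear P" using P by (rule has_derivative_linear)
  define d where "d = min d0 d1 / C"
  have dpos: "d > 0" using d0 d1 C by (simp add: d_def)
  moreover have "\<bar>g (a + h *\<^sub>R v + h *\<^sub>R w) - g (a + h *\<^sub>R v) - g (a + h *\<^sub>R w) + g a - h\<^sup>2 * P w\<bar> \<le> e * h\<^sup>2"
    if h: "0 < h" "h < d" for h
  proof -
    have hC: "h * C < min d0 d1" using h C by (simp add: d_def pos_less_divide_eq)
    \<comment> \<open>all points that occur below lie in both neighbourhoods of \<open>a\<close>\<close>
    have near: "norm (s *\<^sub>R v + t *\<^sub>R w) \<le> h * C" if "0 \<le> s" "s \<le> h" "0 \<le> t" "t \<le> h" for s t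
    proof -
      have "norm (s *\<^sub>R v + t *\<^sub>R w) \<le> s * norm v + t * norm w"
        using norm_triangle_ineq[of "s *\<^sub>R v" "t *\<^sub>R w"] that by simp
      also have "\<dots> \<le> h * norm v + h * norm w"
        using that by (intro add_mono mult_right_mono) auto
      also have "\<dots> \<le> h * C" using h by (simp add: C_def algebra_simps)
      finally show ?thesis .
    qed
    have inS: "a + s *\<^sub>R v + t *\<^sub>R w \<in> S" if "0 \<le> s" "s \<le> h" "0 \<le> t" "t \<le> h" for s t
    proof -
      have "norm (s *\<^sub>R v + t *\<^sub>R w) < d0" using near[OF that] hC by simp
      hence "a + s *\<^sub>R v + t *\<^sub>R w \<in> ball a d0"
        by (metis add.assoc add_diff_cancel_left' dist_norm dist_commute mem_ball)
      thus ?thesis using d0 by blast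
    qed
    have est: "\<bar>G (a + s *\<^sub>R v + t *\<^sub>R w) v - G a v - (s * P v + t * P w)\<bar> \<le> e' * (h * C)"
      if "0 \<le> s" "s \<le> h" "0 \<le> t" "t \<le> h" for s t
    proof -
      have "norm (s *\<^sub>R v + t *\<^sub>R w) < d1" using near[OF that] hC by simp
      hence "\<bar>G (a + s *\<^sub>R v + t *\<^sub>R w) v - G a v - P (s *\<^sub>R v + t *\<^sub>R w)\<bar>
          \<le> e' * norm (s *\<^sub>R v + t *\<^sub>R w)"
        using d1(2)[of "a + s *\<^sub>R v + t *\<^sub>R w"] by (simp add: algebra_simps)
      also have "\<dots> \<le> e' * (h * C)" using near[OF that] e' by simp
      finally show ?thesis using linP by (simp add: linear_add linear_scale)
    qed
    define K where "K = e' * (h * C)"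
    define \<phi> where "\<phi> s = g (a + s *\<^sub>R v + h *\<^sub>R w) - g (a + s *\<^sub>R v + 0 *\<^sub>R w)" for s
    have line: "((\<lambda>s. g (a + s *\<^sub>R v + t *\<^sub>R w)) has_derivative
        (\<lambda>y. y * G (a + s *\<^sub>R v + t *\<^sub>R w) v)) (at s within {0..h})"
      if "0 \<le> s" "s \<le> h" "0 \<le> t" "t \<le> h" for s t
    proof -
      let ?x = "a + s *\<^sub>R v + t *\<^sub>R w"
      have g: "(g has_derivative G ?x) (at ?x)" using G inS[OF that] by blast
      have l: "linear (G ?x)" using g by (rule has_derivative_linear)
      have "((\<lambda>s. a + s *\<^sub>R v + t *\<^sub>R w) has_derivative (\<lambda>y. y *\<^sub>R v)) (at s within {0..h})"
        by (auto intro!: derivative_eq_intros)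
      from has_derivative_compose[OF this g]
      show ?thesis by (simp add: linear_scale[OF l])
    qed
    have "\<exists>\<xi>\<in>{0<..<h}. \<phi> h - \<phi> 0 = (h - 0) * G (a + \<xi> *\<^sub>R v + h *\<^sub>R w) v - (h - 0) * G (a + \<xi> *\<^sub>R v + 0 *\<^sub>R w) v"
      unfolding \<phi>_def using h
      by (intro mvt_simple has_derivative_diff line) auto
    then obtain \<xi> where \<xi>: "0 < \<xi>" "\<xi> < h"
      "\<phi> h - \<phi> 0 = h * (G (a + \<xi> *\<^sub>R v + h *\<^sub>R w) v - G (a + \<xi> *\<^sub>R v + 0 *\<^sub>R w) v)"
      by (auto simp: algebra_simps)
    have "\<bar>G (a + \<xi> *\<^sub>R v + h *\<^sub>R w) v - G (a + \<xi> *\<^sub>R v + 0 *\<^sub>R w) v - h * P w\<bar> \<le> K + K"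
      using est[of \<xi> h, folded K_def] est[of \<xi> 0, folded K_def] \<xi>(1,2) h
      by (simp add: abs_le_iff)
    also have "\<dots> = e * h" using C by (simp add: K_def e'_def field_simps)
    finally have "h * \<bar>G (a + \<xi> *\<^sub>R v + h *\<^sub>R w) v - G (a + \<xi> *\<^sub>R v + 0 *\<^sub>R w) v - h * P w\<bar> \<le> h * (e * h)"
      using h by simp
    moreover have "\<phi> h - \<phi> 0 - h\<^sup>2 * P w
        = h * (G (a + \<xi> *\<^sub>R v + h *\<^sub>R w) v - G (a + \<xi> *\<^sub>R v + 0 *\<^sub>R w) v - h * P w)"
      unfolding \<xi>(3) by (simp add: power2_eq_square algebra_simps)
    ultimately have "\<bar>\<phi> h - \<phi> 0 - h\<^sup>2 * P w\<bar> \<le> e * h\<^sup>2"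
      using h by (simp add: abs_mult power2_eq_square mult.left_commute)
    thus ?thesis by (simp add: \<phi>_def algebra_simps)
  qed
  ultimately show ?thesis by blast
qed

text \<open>The second difference is symmetric in \<open>v\<close> and \<open>w\<close>, so its two asymptotic values agree.\<close>

lemma second_derivative_symmetric_real:
  fixes g :: "'a::real_normed_vector \<Rightarrow> real"
  assumes S: "open S" "a \<in> S"
    and G: "\<And>x. x \<in> S \<Longrightarrow> (g has_derivative G x) (at x)"
    and P: "((\<lambda>x. G x v) has_derivative P) (at a)"
    and Q: "((\<lambda>x. G x w) has_derivative Q) (at a)"
  shows "P w = Q v"
proof -
  have "\<bar>P w - Q v\<bar> \<le> 0 + e" if e: "e > 0" for e
  proof -
    have "e / 2 > 0" using e by simp
    from second_difference_estimate[OF S G P this, of w]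
      second_difference_estimate[OF S G Q this, of v]
    obtain d d' where d: "d > 0" "d' > 0"
      "\<And>h. 0 < h \<and> h < d \<Longrightarrow> \<bar>g (a + h *\<^sub>R v + h *\<^sub>R w) - g (a + h *\<^sub>R v) - g (a + h *\<^sub>R w) + g a - h\<^sup>2 * P w\<bar> \<le> e/2 * h\<^sup>2"
      "\<And>h. 0 < h \<and> h < d' \<Longrightarrow> \<bar>g (a + h *\<^sub>R w + h *\<^sub>R v) - g (a + h *\<^sub>R w) - g (a + h *\<^sub>R v) + g a - h\<^sup>2 * Q v\<bar> \<le> e/2 * h\<^sup>2"
      by blast
    define h where "h = min d d' / 2"
    have h: "0 < h" "h < d" "h < d'" using d by (auto simp: h_def)
    have comm: "a + h *\<^sub>R w + h *\<^sub>R v = a + h *\<^sub>R v + h *\<^sub>R w" by simp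
    have "\<bar>h\<^sup>2 * P w - h\<^sup>2 * Q v\<bar> \<le> e * h\<^sup>2"
      using d(3)[of h] d(4)[of h] h unfolding comm by (simp only: abs_le_iff) simp
    hence "h\<^sup>2 * \<bar>P w - Q v\<bar> \<le> h\<^sup>2 * e"
      by (simp add: abs_mult flip: right_diff_distrib) (simp add: mult.commute)
    thus ?thesis using h by simp
  qed
  hence "\<bar>P w - Q v\<bar> \<le> 0" by (rule field_le_epsilon)
  thus ?thesis by simp
qed

section \<open>Calculus of partial derivatives\<close>

lemma partial_deriv_eq:
  assumes "(f has_derivative D) (at x)"
  shows "partial_deriv j f x = D (axis j 1)"
proof -
  have l: "linear D" using assms by (rule has_derivative_linear)
  have "((\<lambda>t. x + t *\<^sub>R axis j 1) has_derivative (\<lambda>t. t *\<^sub>R axis j 1)) (at 0)"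
    by (auto intro!: derivative_eq_intros)
  from has_derivative_compose[OF this, of f D] assms
  have "((\<lambda>t. f (x + t *\<^sub>R axis j 1)) has_derivative (\<lambda>t. t *\<^sub>R D (axis j 1))) (at 0)"
    by (simp add: linear_scale[OF l])
  thus ?thesis unfolding partial_deriv_def
    by (intro vector_derivative_at) (simp add: has_vector_derivative_def)
qed

lemma partial_deriv_cong:
  assumes "open S" "x \<in> S" "\<And>y. y \<in> S \<Longrightarrow> f y = g y"
  shows "partial_deriv j f x = partial_deriv j g x"
proof -
  have "continuous_on UNIV (\<lambda>t. x + t *\<^sub>R axis j 1)" by (intro continuous_intros)
  hence o: "open ((\<lambda>t. x + t *\<^sub>R axis j 1) -` S)" using assms(1) by (simp add: open_vimage)
  have "eventually (\<lambda>t. t \<in> (\<lambda>t. x + t *\<^sub>R axis j 1) -` S) (nhds 0)"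
    using assms(2) by (intro eventually_nhds_in_open[OF o]) simp
  hence "eventually (\<lambda>t. f (x + t *\<^sub>R axis j 1) = g (x + t *\<^sub>R axis j 1)) (nhds 0)"
    by eventually_elim (use assms(3) in auto)
  thus ?thesis unfolding partial_deriv_def
    by (intro vector_derivative_cong_eq) (auto elim: eventually_mono)
qed

lemma differentiable_cong_open:
  assumes "open S" "x \<in> S" "\<And>y. y \<in> S \<Longrightarrow> f y = g y" "g differentiable (at x)"
  shows "f differentiable (at x)"
proof -
  from assms(4) obtain D where "(g has_derivative D) (at x)" unfolding differentiable_def by blast
  hence "(f has_derivative D) (at x)"
    using has_derivative_transform_within_open[of g D x UNIV S f] assms by simp
  thus ?thesis unfolding differentiable_def by blast
qed

lemma partial_deriv_inner:
  fixes f g :: "real^'n::finite \<Rightarrow> 'b::real_inner"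
  assumes "f differentiable (at x)" "g differentiable (at x)"
  shows "partial_deriv j (\<lambda>y. f y \<bullet> g y) x = f x \<bullet> partial_deriv j g x + partial_deriv j f x \<bullet> g x"
proof -
  obtain F G where D: "(f has_derivative F) (at x)" "(g has_derivative G) (at x)"
    using assms unfolding differentiable_def by blast
  show ?thesis
    using partial_deriv_eq[OF has_derivative_inner[OF D]] partial_deriv_eq[OF D(1)] partial_deriv_eq[OF D(2)]
    by simp
qed

lemma partial_deriv_mult:
  fixes f g :: "real^'n::finite \<Rightarrow> real"
  assumes "f differentiable (at x)" "g differentiable (at x)"
  shows "partial_deriv j (\<lambda>y. f y * g y) x = f x * partial_deriv j g x + partial_deriv j f x * g x"
  using partial_deriv_inner[OF assms] by simp

lemma partial_deriv_diff:
  assumes "f differentiable (at x)" "g differentiable (at x)"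
  shows "partial_deriv j (\<lambda>y. f y - g y) x = partial_deriv j f x - partial_deriv j g x"
proof -
  obtain F G where D: "(f has_derivative F) (at x)" "(g has_derivative G) (at x)"
    using assms unfolding differentiable_def by blast
  show ?thesis
    using partial_deriv_eq[OF has_derivative_diff[OF D]] partial_deriv_eq[OF D(1)] partial_deriv_eq[OF D(2)]
    by simp
qed

lemma partial_deriv_add:
  assumes "f differentiable (at x)" "g differentiable (at x)"
  shows "partial_deriv j (\<lambda>y. f y + g y) x = partial_deriv j f x + partial_deriv j g x"
proof -
  obtain F G where D: "(f has_derivative F) (at x)" "(g has_derivative G) (at x)"
    using assms unfolding differentiable_def by blast
  show ?thesis
    using partial_deriv_eq[OF has_derivative_add[OF D]] partial_deriv_eq[OF D(1)] partial_deriv_eq[OF D(2)]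
    by simp
qed

lemma partial_deriv_const: "partial_deriv j (\<lambda>y. k) x = 0"
  using partial_deriv_eq[OF has_derivative_const] .

lemma partial_deriv_cmult:
  fixes f :: "real^'n::finite \<Rightarrow> real"
  assumes "f differentiable (at x)"
  shows "partial_deriv j (\<lambda>y. k * f y) x = k * partial_deriv j f x"
  using partial_deriv_mult[OF differentiable_const assms] by (simp add: partial_deriv_const)

text \<open>
  Pairing with an arbitrary vector \<open>b\<close> reduces the claim to real-valued functions, where the mean
  value theorem is available.
\<close>

lemma partial_deriv_commute:
  fixes f :: "real^'n::finite \<Rightarrow> 'b::real_inner"
  assumes S: "open S" "x \<in> S"
    and f: "\<And>y. y \<in> S \<Longrightarrow> f differentiable (at y)"
    and ij: "partial_deriv i f differentiable (at x)" "partial_deriv j f differentiable (at x)"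
  shows "partial_deriv j (partial_deriv i f) x = partial_deriv i (partial_deriv j f) x"
proof (rule vector_eq_rdot[THEN iffD1], rule allI)
  fix b
  let ?F = "\<lambda>y. frechet_derivative f (at y)"
  have F: "(f has_derivative ?F y) (at y)" if "y \<in> S" for y
    using f[OF that] by (simp add: frechet_derivative_works)
  have Fb: "((\<lambda>z. f z \<bullet> b) has_derivative (\<lambda>v. ?F y v \<bullet> b)) (at y)" if "y \<in> S" for y
    using has_derivative_inner_left[OF F[OF that]] .
  have second: "((\<lambda>y. ?F y (axis k 1) \<bullet> b) has_derivative (\<lambda>v. D v \<bullet> b)) (at x)"
    if D: "(partial_deriv k f has_derivative D) (at x)" for k D
    using has_derivative_inner_left[OF D, of b]
      has_derivative_transform_within_open[of "\<lambda>y. partial_deriv k f y \<bullet> b" "\<lambda>v. D v \<bullet> b" x UNIV S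
        "\<lambda>y. ?F y (axis k 1) \<bullet> b"] S partial_deriv_eq[OF F]
    by simp
  obtain P Q where D: "(partial_deriv i f has_derivative P) (at x)" "(partial_deriv j f has_derivative Q) (at x)"
    using ij unfolding differentiable_def by blast
  have "P (axis j 1) \<bullet> b = Q (axis i 1) \<bullet> b"
    using second_derivative_symmetric_real[OF S Fb second[OF D(1)] second[OF D(2)]] .
  thus "partial_deriv j (partial_deriv i f) x \<bullet> b = partial_deriv i (partial_deriv j f) x \<bullet> b"
    using partial_deriv_eq[OF D(1)] partial_deriv_eq[OF D(2)] by simp
qed

section \<open>The Gauss equation of a conformally parametrized sphere\<close>

text \<open>
  Used to compute inner products of second derivatives of a surface in its moving frame of
  tangent and normal vectors, which is orthogonal but not normalized.
\<close>

lemma inner_orthogonal_basis: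
  fixes B :: "'a::euclidean_space set"
  assumes orth: "pairwise orthogonal B" and "0 \<notin> B" and card: "card B = DIM('a)"
  shows "x \<bullet> y = (\<Sum>b\<in>B. (x \<bullet> b) * (y \<bullet> b) / (b \<bullet> b))"
proof -
  have fin: "finite B" using card by (metis DIM_positive card.infinite less_irrefl)
  have ind: "independent B" using pairwise_orthogonal_independent[OF assms(1,2)] .
  have span: "span B = UNIV"
    using card_ge_dim_independent[of B UNIV] ind card by (auto simp: dim_UNIV)
  define z where "z = x - (\<Sum>b\<in>B. ((x \<bullet> b) / (b \<bullet> b)) *\<^sub>R b)"
  have "orthogonal z b" if b: "b \<in> B" for b
  proof -
    have "(\<Sum>a\<in>B. ((x \<bullet> a) / (a \<bullet> a)) *\<^sub>R a) \<bullet> b = (\<Sum>a\<in>B. ((x \<bullet> a) / (a \<bullet> a)) * (a \<bullet> b))"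
      by (simp add: inner_sum_left)
    also have "\<dots> = (\<Sum>a\<in>B. if a = b then x \<bullet> b else 0)"
      using orth b assms(2) by (intro sum.cong) (auto simp: pairwise_def orthogonal_def)
    also have "\<dots> = x \<bullet> b" using fin b by simp
    finally show ?thesis by (simp add: z_def orthogonal_def inner_diff_left)
  qed
  hence "orthogonal z z"
    using orthogonal_to_span[of z B z] span by auto
  hence "x = (\<Sum>b\<in>B. ((x \<bullet> b) / (b \<bullet> b)) *\<^sub>R b)" by (simp add: z_def orthogonal_def)
  hence "y \<bullet> x = y \<bullet> (\<Sum>b\<in>B. ((x \<bullet> b) / (b \<bullet> b)) *\<^sub>R b)" by simp
  also have "\<dots> = (\<Sum>b\<in>B. (x \<bullet> b) * (y \<bullet> b) / (b \<bullet> b))"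
    by (simp add: inner_sum_right)
  finally show ?thesis by (simp only: inner_commute[of y x])
qed

text \<open>
  The quantity \<open>f\<^sub>u\<^sub>u \<bullet> f\<^sub>v\<^sub>v - f\<^sub>u\<^sub>v \<bullet> f\<^sub>u\<^sub>v\<close> is computed twice. Differentiating the three relations
  \<open>f\<^sub>u \<bullet> f\<^sub>u = E\<close>, \<open>f\<^sub>v \<bullet> f\<^sub>v = E\<close>, \<open>f\<^sub>u \<bullet> f\<^sub>v = 0\<close> twice gives \<open>- \<Delta>E / 2\<close>: the third derivatives of
  \<open>f\<close> cancel because they are symmetric. On the other hand, the inner products of the
  second derivatives with \<open>f\<^sub>u\<close> and \<open>f\<^sub>v\<close> are first derivatives of \<open>E\<close> up to factors
  \<open>\<plusminus> 1 / 2\<close>, while those with the normal \<open>f - c\<close> follow from \<open>|f - c| = r\<close>; expanding in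
  this frame gives \<open>E\<^sup>2 / r\<^sup>2 - |\<nabla>E|\<^sup>2 / (2 E)\<close>.
\<close>

lemma gauss_equation_conformal_sphere:
  fixes f :: "real^2 \<Rightarrow> real^3" and E :: "real^2 \<Rightarrow> real"
  assumes r: "r > 0" and U: "open U" and x: "x \<in> U" and f: "C_k_on 3 f U"
    and sph: "f ` U \<subseteq> sphere c r"
    and I: "\<And>y i j. y \<in> U \<Longrightarrow> first_fundamental_form f i j y = E y * kronecker_delta i j"
    and E0: "E x > 0"
  shows "E x * (partial_deriv 1 (partial_deriv 1 E) x + partial_deriv 2 (partial_deriv 2 E) x)
       = (partial_deriv 1 E x)\<^sup>2 + (partial_deriv 2 E x)\<^sup>2 - 2 * E x ^ 3 / r\<^sup>2"
proof -
  define A B where "A = partial_deriv 1 f" and "B = partial_deriv 2 f"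
  define X11 X12 X22 where "X11 = partial_deriv 1 A" and "X12 = partial_deriv 2 A" and "X22 = partial_deriv 2 B"
  have d0: "f differentiable (at y)" if "y \<in> U" for y
    using f that by (simp add: numeral_3_eq_3)
  have d1: "partial_deriv i f differentiable (at y)" if "y \<in> U" for y i
    using f that by (simp add: numeral_3_eq_3)
  have d2: "partial_deriv i (partial_deriv j f) differentiable (at y)" if "y \<in> U" for y i j
    using f that by (simp add: numeral_3_eq_3)
  have dA: "A differentiable (at y)" "B differentiable (at y)" "X11 differentiable (at y)"
    "X12 differentiable (at y)" "X22 differentiable (at y)" if "y \<in> U" for y
    unfolding A_def B_def X11_def X12_def X22_def using d1 d2 that by auto
  have X21: "partial_deriv 1 B y = X12 y" if "y \<in> U" for y
    unfolding A_def B_def X12_def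
    using partial_deriv_commute[OF U that d0 d1 d1] that by simp
  have X112: "partial_deriv 2 X11 x = partial_deriv 1 X12 x"
    unfolding X11_def X12_def
    using partial_deriv_commute[OF U x dA(1)] x dA(3,4) unfolding X11_def X12_def by blast
  have EA: "E y = A y \<bullet> A y" and EB: "E y = B y \<bullet> B y" and F0: "A y \<bullet> B y = 0" if "y \<in> U" for y
    using I[OF that, of 1 1] I[OF that, of 2 2] I[OF that, of 1 2]
    by (simp_all add: first_fundamental_form_def kronecker_delta_def A_def B_def)
  \<comment> \<open>each derivative of \<open>E\<close> is expressed through \<open>E = A \<bullet> A\<close> and through \<open>E = B \<bullet> B\<close>: together with
    the derivatives of \<open>A \<bullet> B = 0\<close> this yields all tangential components of \<open>X11\<close>, \<open>X12\<close>, \<open>X22\<close>\<close>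
  have E1: "partial_deriv 1 E y = 2 * (A y \<bullet> X11 y)"
   and E2: "partial_deriv 2 E y = 2 * (A y \<bullet> X12 y)" if y: "y \<in> U" for y
    using partial_deriv_cong[OF U y EA] partial_deriv_inner[OF dA(1)[OF y] dA(1)[OF y]]
    by (simp_all add: X11_def X12_def inner_commute)
  have G1: "partial_deriv 1 E y = 2 * (B y \<bullet> X12 y)"
   and G2: "partial_deriv 2 E y = 2 * (B y \<bullet> X22 y)" if y: "y \<in> U" for y
    using partial_deriv_cong[OF U y EB] partial_deriv_inner[OF dA(2)[OF y] dA(2)[OF y]] X21[OF y]
    by (simp_all add: X22_def inner_commute)
  have dF: "A y \<bullet> partial_deriv j B y + partial_deriv j A y \<bullet> B y = 0" if y: "y \<in> U" for y j
    using partial_deriv_cong[OF U y, of "\<lambda>y. A y \<bullet> B y" "\<lambda>y. 0" j, OF F0]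
      partial_deriv_inner[OF dA(1)[OF y] dA(2)[OF y], of j]
    by (simp add: partial_deriv_const)
  have F1: "A y \<bullet> X12 y + X11 y \<bullet> B y = 0"
   and F2: "A y \<bullet> X22 y + X12 y \<bullet> B y = 0" if y: "y \<in> U" for y
    using dF[OF y, of 1] dF[OF y, of 2] X21[OF y] by (simp_all add: X22_def X11_def X12_def)
  \<comment> \<open>the expressions for \<open>E\<^sub>u\<close> and \<open>E\<^sub>v\<close> are chosen so that only derivatives of \<open>X12\<close> appear\<close>
  note diffs = dA[OF x] differentiable_inner
  have E11: "partial_deriv 1 (partial_deriv 1 E) x = 2 * (X12 x \<bullet> X12 x) + 2 * (B x \<bullet> partial_deriv 1 X12 x)"
    using partial_deriv_cong[OF U x, of "partial_deriv 1 E" "\<lambda>y. 2 * (B y \<bullet> X12 y)" 1, OF G1] X21[OF x]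
    by (simp add: partial_deriv_cmult partial_deriv_inner diffs)
  have E22: "partial_deriv 2 (partial_deriv 2 E) x = 2 * (X12 x \<bullet> X12 x) + 2 * (A x \<bullet> partial_deriv 2 X12 x)"
    using partial_deriv_cong[OF U x, of "partial_deriv 2 E" "\<lambda>y. 2 * (A y \<bullet> X12 y)" 2, OF E2]
    by (simp add: partial_deriv_cmult partial_deriv_inner diffs X12_def[symmetric])
  have F12: "A x \<bullet> partial_deriv 2 X12 x + X12 x \<bullet> X12 x + (X11 x \<bullet> X22 x + partial_deriv 1 X12 x \<bullet> B x) = 0"
    using partial_deriv_cong[OF U x, of "\<lambda>y. A y \<bullet> X12 y + X11 y \<bullet> B y" "\<lambda>y. 0" 2, OF F1] X112
    by (simp add: partial_deriv_add partial_deriv_inner partial_deriv_const diffs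
        X12_def[symmetric] X22_def[symmetric])
  have lap: "partial_deriv 1 (partial_deriv 1 E) x + partial_deriv 2 (partial_deriv 2 E) x
     = 2 * (X12 x \<bullet> X12 x) - 2 * (X11 x \<bullet> X22 x)"
    using E11 E22 F12 by (simp add: inner_commute algebra_simps)
  \<comment> \<open>for a sphere the position vector relative to the centre is normal to the surface\<close>
  define N where "N y = f y - c" for y
  have dN: "N differentiable (at y)" and N1: "partial_deriv 1 N y = A y" and N2: "partial_deriv 2 N y = B y"
    if "y \<in> U" for y
    unfolding N_def A_def B_def using d0[OF that]
    by (auto simp: partial_deriv_diff partial_deriv_const)
  have NN: "N y \<bullet> N y = r\<^sup>2" if "y \<in> U" for y
    using sph that by (auto simp: N_def dist_norm norm_minus_commute power2_norm_eq_inner[symmetric])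
  have dNN: "N y \<bullet> partial_deriv j N y = 0" if y: "y \<in> U" for y j
    using partial_deriv_cong[OF U y, of "\<lambda>y. N y \<bullet> N y" "\<lambda>y. r\<^sup>2" j, OF NN]
      partial_deriv_inner[OF dN[OF y] dN[OF y], of j]
    by (simp add: partial_deriv_const inner_commute)
  have AN: "A y \<bullet> N y = 0" and BN: "B y \<bullet> N y = 0" if y: "y \<in> U" for y
    using dNN[OF y, of 1] dNN[OF y, of 2] N1[OF y] N2[OF y] by (simp_all add: inner_commute)
  have dAN: "A x \<bullet> partial_deriv j N x + partial_deriv j A x \<bullet> N x = 0"
   and dBN: "B x \<bullet> partial_deriv j N x + partial_deriv j B x \<bullet> N x = 0" for j
    using partial_deriv_cong[OF U x, of "\<lambda>y. A y \<bullet> N y" "\<lambda>y. 0" j, OF AN]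
      partial_deriv_cong[OF U x, of "\<lambda>y. B y \<bullet> N y" "\<lambda>y. 0" j, OF BN]
      partial_deriv_inner[OF dA(1)[OF x] dN[OF x], of j] partial_deriv_inner[OF dA(2)[OF x] dN[OF x], of j]
    by (simp_all add: partial_deriv_const)
  have N11: "X11 x \<bullet> N x = - E x" and N12: "X12 x \<bullet> N x = 0" and N22: "X22 x \<bullet> N x = - E x"
    using dAN[of 1] dAN[of 2] dBN[of 2] N1[OF x] N2[OF x] EA[OF x] EB[OF x] F0[OF x]
    by (simp_all add: X11_def X12_def X22_def)
  have AA: "A x \<bullet> A x = E x" and BB: "B x \<bullet> B x = E x" and AB: "A x \<bullet> B x = 0"
   and NNx: "N x \<bullet> N x = r\<^sup>2" and ANx: "A x \<bullet> N x = 0" and BNx: "B x \<bullet> N x = 0"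
    using EA EB F0 NN AN BN x by auto
  have nz: "A x \<noteq> 0" "B x \<noteq> 0" "N x \<noteq> 0" using AA BB NNx E0 r by auto
  have dist: "A x \<noteq> B x" "A x \<noteq> N x" "B x \<noteq> N x" using AB ANx BNx nz by auto
  have frame: "v \<bullet> w = (v \<bullet> A x) * (w \<bullet> A x) / E x + (v \<bullet> B x) * (w \<bullet> B x) / E x
      + (v \<bullet> N x) * (w \<bullet> N x) / r\<^sup>2" for v w
  proof -
    have "pairwise orthogonal {A x, B x, N x}"
      using AB ANx BNx by (auto simp: pairwise_def orthogonal_def inner_commute)
    from inner_orthogonal_basis[OF this, of v w] show ?thesis
      using dist nz by (simp add: AA BB NNx)
  qed
  define p q where "p = partial_deriv 1 E x" and "q = partial_deriv 2 E x"
  have comps: "X11 x \<bullet> A x = p / 2" "X11 x \<bullet> B x = - q / 2" "X12 x \<bullet> A x = q / 2" "X12 x \<bullet> B x = p / 2"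
     "X22 x \<bullet> A x = - p / 2" "X22 x \<bullet> B x = q / 2"
    using E1[OF x] E2[OF x] G1[OF x] G2[OF x] F1[OF x] F2[OF x]
    by (simp_all add: p_def q_def inner_commute)
  have "2 * (X12 x \<bullet> X12 x) - 2 * (X11 x \<bullet> X22 x) = (p\<^sup>2 + q\<^sup>2) / E x - 2 * (E x)\<^sup>2 / r\<^sup>2"
    unfolding frame[of "X12 x" "X12 x"] frame[of "X11 x" "X22 x"] comps N11 N12 N22
    using E0 r by (simp add: power2_eq_square field_simps)
  thus ?thesis unfolding lap using E0 r
    by (simp add: p_def[symmetric] q_def[symmetric] power2_eq_square power3_eq_cube field_simps)
qed

section \<open>Positive harmonic functions with cubic squared gradient\<close>

text \<open>
  Write \<open>p = E\<^sub>u\<close>, \<open>q = E\<^sub>v\<close>, \<open>a = E\<^sub>u\<^sub>u = - E\<^sub>v\<^sub>v\<close>, \<open>b = E\<^sub>u\<^sub>v\<close>. The derivatives of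
  \<open>p\<^sup>2 + q\<^sup>2 = k E\<^sup>3\<close> are two linear equations for \<open>a\<close> and \<open>b\<close> with determinant \<open>4 (p\<^sup>2 + q\<^sup>2)\<close>; their
  solution is \<open>2 a E = 3 (p\<^sup>2 - q\<^sup>2)\<close>, \<open>b E = 3 p q\<close>, that is \<open>2 E h' = 3 h\<^sup>2\<close> for the holomorphic
  function \<open>h = p - i q\<close>. Hence \<open>E\<close> is holomorphic as well, and being real it has vanishing
  gradient. In real terms, the Cauchy-Riemann equations \<open>a\<^sub>v = b\<^sub>u\<close>, \<open>b\<^sub>v = - a\<^sub>u\<close> for \<open>h'\<close>, applied to
  this solution, give \<open>p b = q a\<close> and \<open>p a + q b = 0\<close>, which force \<open>p = q = 0\<close>.
\<close>

lemma no_positive_harmonic_gradient_cubic: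
  fixes E :: "real^2 \<Rightarrow> real"
  assumes k: "k > 0" and U: "open U" and x: "x \<in> U"
    and E0: "\<And>y. y \<in> U \<Longrightarrow> E y > 0" and harm: "harmonic_on E U"
    and grad: "\<And>y. y \<in> U \<Longrightarrow> (partial_deriv 1 E y)\<^sup>2 + (partial_deriv 2 E y)\<^sup>2 = k * E y ^ 3"
  shows False
proof -
  define p q where "p = partial_deriv 1 E" and "q = partial_deriv 2 E"
  define a b where "a = partial_deriv 1 p" and "b = partial_deriv 2 p"
  have dE: "E differentiable (at y)" if "y \<in> U" for y
    using harm that by (simp add: harmonic_on_def numeral_2_eq_2)
  have dP: "partial_deriv i E differentiable (at y)" if "y \<in> U" for y i
    using harm that by (simp add: harmonic_on_def numeral_2_eq_2)
  have dp: "p differentiable (at y)" and dq: "q differentiable (at y)" if "y \<in> U" for y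
    unfolding p_def q_def using dP that by auto
  have q1: "partial_deriv 1 q y = b y" if "y \<in> U" for y
    unfolding p_def q_def b_def using partial_deriv_commute[OF U that dE dP dP] that by simp
  have q2: "partial_deriv 2 q y = - a y" if "y \<in> U" for y
    using harm that unfolding p_def q_def a_def harmonic_on_def by (simp add: eq_neg_iff_add_eq_0 add.commute)
  have g: "p y * p y + q y * q y = k * (E y * (E y * E y))" if "y \<in> U" for y
    using grad[OF that] by (simp add: p_def q_def power2_eq_square power3_eq_cube algebra_simps)
  note diffs = differentiable_mult differentiable_add differentiable_diff differentiable_divide
    differentiable_const
  note rules = partial_deriv_add partial_deriv_diff partial_deriv_mult partial_deriv_cmult partial_deriv_const
  have grad_dir: "2 * (p y * partial_deriv i p y + q y * partial_deriv i q y)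
      = 3 * k * (E y * E y) * partial_deriv i E y" if y: "y \<in> U" for y i
  proof -
    have "partial_deriv i (\<lambda>z. p z * p z + q z * q z) y = partial_deriv i (\<lambda>z. k * (E z * (E z * E z))) y"
      by (rule partial_deriv_cong[OF U y g])
    thus ?thesis
      by (simp add: rules diffs dE[OF y] dp[OF y] dq[OF y] algebra_simps)
  qed
  have ab: "2 * (a y * E y) = 3 * (p y * p y - q y * q y)" "b y * E y = 3 * (p y * q y)"
    if y: "y \<in> U" for y
  proof -
    have 1: "2 * (p y * a y + q y * b y) = 3 * k * (E y * E y) * p y"
      and 2: "2 * (p y * b y - q y * a y) = 3 * k * (E y * E y) * q y"
      using grad_dir[OF y, of 1] grad_dir[OF y, of 2] q1[OF y] q2[OF y]
      by (simp_all add: a_def b_def p_def q_def)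
    have nz: "k * (E y * E y) \<noteq> 0" using k E0[OF y] by simp
    have "k * (E y * E y) * (2 * (a y * E y)) = 2 * a y * (p y * p y + q y * q y)"
      unfolding g[OF y] by (simp add: algebra_simps)
    also have "\<dots> = p y * (2 * (p y * a y + q y * b y)) - q y * (2 * (p y * b y - q y * a y))"
      by (simp add: algebra_simps)
    also have "\<dots> = k * (E y * E y) * (3 * (p y * p y - q y * q y))"
      unfolding 1 2 by (simp add: algebra_simps)
    finally show "2 * (a y * E y) = 3 * (p y * p y - q y * q y)" using nz by (simp only: mult_cancel_left) simp
    have "k * (E y * E y) * (2 * (b y * E y)) = 2 * b y * (p y * p y + q y * q y)"
      unfolding g[OF y] by (simp add: algebra_simps)
    also have "\<dots> = q y * (2 * (p y * a y + q y * b y)) + p y * (2 * (p y * b y - q y * a y))"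
      by (simp add: algebra_simps)
    also have "\<dots> = k * (E y * E y) * (2 * (3 * (p y * q y)))"
      unfolding 1 2 by (simp add: algebra_simps)
    finally show "b y * E y = 3 * (p y * q y)" using nz by (simp only: mult_cancel_left) simp
  qed
  \<comment> \<open>differentiability of the second derivatives of \<open>E\<close> is read off from these formulas\<close>
  have da: "a differentiable (at x)"
  proof (rule differentiable_cong_open[OF U x])
    show "a y = 3 * (p y * p y - q y * q y) / (2 * E y)" if "y \<in> U" for y
      using ab(1)[OF that] E0[OF that] by (simp add: field_simps)
    show "(\<lambda>y. 3 * (p y * p y - q y * q y) / (2 * E y)) differentiable (at x)"
      using dE[OF x] dp[OF x] dq[OF x] E0[OF x] by (intro diffs) auto
  qed
  have db: "b differentiable (at x)"
  proof (rule differentiable_cong_open[OF U x])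
    show "b y = 3 * (p y * q y) / E y" if "y \<in> U" for y
      using ab(2)[OF that] E0[OF that] by (simp add: field_simps)
    show "(\<lambda>y. 3 * (p y * q y) / E y) differentiable (at x)"
      using dE[OF x] dp[OF x] dq[OF x] E0[OF x] by (intro diffs) auto
  qed
  have dq1: "partial_deriv 1 q differentiable (at x)"
    by (rule differentiable_cong_open[OF U x q1 db])
  have dq2: "partial_deriv 2 q differentiable (at x)"
    by (rule differentiable_cong_open[OF U x q2]) (use da in auto)
  have a2: "partial_deriv 2 a x = partial_deriv 1 b x"
    using partial_deriv_commute[OF U x dp] da db unfolding a_def b_def by blast
  have "partial_deriv 2 b x = partial_deriv 2 (partial_deriv 1 q) x"
    by (rule partial_deriv_cong[OF U x q1[symmetric]])
  also have "\<dots> = partial_deriv 1 (partial_deriv 2 q) x"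
    by (rule partial_deriv_commute[OF U x dq dq1 dq2])
  also have "\<dots> = partial_deriv 1 (\<lambda>y. (-1) * a y) x"
    by (rule partial_deriv_cong[OF U x]) (simp add: q2)
  also have "\<dots> = (-1) * partial_deriv 1 a x" by (rule partial_deriv_cmult[OF da])
  finally have b2: "partial_deriv 2 b x = - partial_deriv 1 a x" by simp
  have diff_a: "2 * (a x * partial_deriv i E x + partial_deriv i a x * E x)
      = 6 * (p x * partial_deriv i p x - q x * partial_deriv i q x)" for i
  proof -
    have "partial_deriv i (\<lambda>y. 2 * (a y * E y)) x = partial_deriv i (\<lambda>y. 3 * (p y * p y - q y * q y)) x"
      by (rule partial_deriv_cong[OF U x ab(1)])
    thus ?thesis
      by (simp add: rules diffs dE[OF x] dp[OF x] dq[OF x] da algebra_simps)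
  qed
  have diff_b: "b x * partial_deriv i E x + partial_deriv i b x * E x
      = 3 * (p x * partial_deriv i q x + partial_deriv i p x * q x)" for i
  proof -
    have "partial_deriv i (\<lambda>y. b y * E y) x = partial_deriv i (\<lambda>y. 3 * (p y * q y)) x"
      by (rule partial_deriv_cong[OF U x ab(2)])
    thus ?thesis
      by (simp add: rules diffs dE[OF x] dp[OF x] dq[OF x] db algebra_simps)
  qed
  have pd: "partial_deriv 1 E x = p x" "partial_deriv 2 E x = q x"
    "partial_deriv 1 p x = a x" "partial_deriv 2 p x = b x"
    by (simp_all add: p_def q_def a_def b_def)
  have z1: "p x * b x - q x * a x = 0"
    using diff_a[of 2] diff_b[of 1] unfolding a2 pd q1[OF x] q2[OF x] by (simp add: algebra_simps)
  have z2: "p x * a x + q x * b x = 0"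
    using diff_a[of 1] diff_b[of 2] unfolding b2 pd q1[OF x] q2[OF x] by (simp add: algebra_simps)
  have "3 * k * (E x * E x) * p x = 2 * (p x * a x + q x * b x)"
    using grad_dir[OF x, of 1] unfolding pd q1[OF x] by simp
  hence p0: "p x = 0" using z2 k E0[OF x] by simp
  have "3 * k * (E x * E x) * q x = 2 * (p x * b x - q x * a x)"
    using grad_dir[OF x, of 2] unfolding pd q2[OF x] by simp
  hence "q x = 0" using z1 k E0[OF x] by simp
  with p0 show False using g[OF x] k E0[OF x] by simp
qed

section \<open>Spheres have no harmonic isothermal parametrization\<close>

theorem mainTheorem2:
  fixes c :: "real^3" and r :: real and U :: "(real^2) set"
  assumes "r > 0"
    and "open U" and "connected U" and "U \<noteq> {}"
  shows "\<not> (\<exists>(f :: real^2 \<Rightarrow> real^3) (E :: real^2 \<Rightarrow> real).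
           smooth_immersion_on f U \<and> f ` U \<subseteq> sphere c r \<and>
           (\<forall>x\<in>U. \<forall>i j. first_fundamental_form f i j x = E x * kronecker_delta i j) \<and>
           (\<forall>x\<in>U. E x > 0) \<and> harmonic_on E U)"
proof (rule notI, elim exE conjE)
  fix f :: "real^2 \<Rightarrow> real^3" and E :: "real^2 \<Rightarrow> real"
  assume f: "smooth_immersion_on f U" and sph: "f ` U \<subseteq> sphere c r"
    and I: "\<forall>x\<in>U. \<forall>i j. first_fundamental_form f i j x = E x * kronecker_delta i j"
    and E0: "\<forall>x\<in>U. E x > 0" and harm: "harmonic_on E U"
  obtain x0 where x0: "x0 \<in> U" using assms by blast
  have C3: "C_k_on 3 f U" using f unfolding smooth_immersion_on_def smooth_on_def by blast
  have "(partial_deriv 1 E x)\<^sup>2 + (partial_deriv 2 E x)\<^sup>2 = 2 / r\<^sup>2 * E x ^ 3" if x: "x \<in> U" for x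
    using gauss_equation_conformal_sphere[OF \<open>r > 0\<close> \<open>open U\<close> x C3 sph, of E] I E0 x harm
    unfolding harmonic_on_def by simp
  thus False
    using no_positive_harmonic_gradient_cubic[of "2 / r\<^sup>2" U x0 E] assms(1,2) x0 E0 harm by simp
qed

end
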